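(* On a $2\times n_H$ two-row grid ($n_H=\lceil n/2\rceil$) using nearest-neighbor SWAPs, routing one top-level GPS block driven by a closed Gray-code transition sequence $G=(f_0,\dots,f_{2^{n_H}-1})$ (by moving along the offset-state ring, see context) incurs routing-added CNOT depth and gate count $$D^{\mathrm{GPS}\text{-}2\mathrm L}_{\mathrm{route}}(n)=3J=3\mu_{\mathrm{jump}}2^{n_H},\qquad S^{\mathrm{GPS}\text{-}2\mathrm L}_{\mathrm{route}}(n)=3(n_H-1)J=3(n_H-1)\mu_{\mathrm{jump}}2^{n_H},$$ where $J=\sum_{t=0}^{2^{n_H}-1}\mathrm{Dist}_{n_H}\bigl(f_t,f_{(t+1)\bmod 2^{n_H}}\bigr)$ and $\mu_{\mathrm{jump}}=J/2^{n_H}$.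
   Context: $\mathrm{Dist}_m(a,b)=\min(|a-b|,m-|a-b|)$. A closed Gray-code transition sequence on $m$ coordinates is $(f_0,\dots,f_{2^m-1})$, $f_t\in\{0,\dots,m-1\}$, such that successively flipping these coordinates starting at $0\in\mathbb F_2^m$ visits every element once and returns to $0$. Two-row grid: upper row sites and lower row sites in columns $0,\dots,n_H-1$; horizontal nearest-neighbor edges within rows and one vertical edge per column. High qubits $h_0,\dots,h_{n_H-1}$ are on the upper row, low qubits $l_0,\dots,l_{n_H-1}$ on the lower row (if $n$ is odd one low label is an idle site). If column $i$ carries $h_{\pi_H(i)}$ and $l_{\pi_L(i)}$, its offset is $(\pi_L(i)-\pi_H(i))\bmod n_H$; the layout is in offset state $s_d$ if all (non-idle) columns have offset $d$. In $s_d$ the vertical edges carry the matching $\{(h_a,l_{a+d})\}$. The canonical arrangement ($s_0$) has label $\sigma(j)$ on both rows of column $j$, with $\sigma(2k)=k$, $\sigma(2k+1)=n_H-1-k$. SWAP-A is the parallel layer swapping upper-row column pairs $(0,1),(2,3),\dots$ and lower-row column pairs $(1,2),(3,4),\dots$; SWAP-B swaps upper-row pairs $(1,2),(3,4),\dots$ and lower-row pairs $(0,1),(2,3),\dots$. Each is one SWAP layer with $n_H-1$ SWAPs. Routing one GPS block means: visit the offset states $s_{f_0},s_{f_1},\dots,s_{f_{2^{n_H}-1}}$ in order by SWAP-A/SWAP-B layers, moving between consecutive states with the minimum number of layers, executing the matching at each visited state on the vertical edges, and returning from the last state to $s_{f_0}$. Routing-added cost counts only SWAPs between states, each SWAP being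 3 CNOTs (depth 3); the internal closed-cycle cost is meant, without the $O(1)$ boundary correction for entering from $s_0$. *)

theory Defs
  imports Complex_Main "HOL-Library.Z2"
begin

text \<open>Vectors of $\mathbb F_2^m$ are functions into \<^typ>\<open>bit\<close> that vanish outside the
  coordinates \<open>0, \<dots>, m - 1\<close>.\<close>

definition F2_vectors :: "nat \<Rightarrow> (nat \<Rightarrow> bit) set" where
  "F2_vectors m = {v. \<forall>i\<ge>m. v i = 0}"

primrec gray_walk :: "nat list \<Rightarrow> nat \<Rightarrow> nat \<Rightarrow> bit" where
  "gray_walk G 0 = (\<lambda>_. 0)"
| "gray_walk G (Suc t) = (gray_walk G t)(G ! t := gray_walk G t (G ! t) + 1)"

definition closed_gray_code :: "nat \<Rightarrow> nat list \<Rightarrow> bool" where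
  "closed_gray_code m G \<longleftrightarrow>
     length G = 2 ^ m \<and> set G \<subseteq> {..<m} \<and>
     bij_betw (gray_walk G) {..<2 ^ m} (F2_vectors m) \<and>
     gray_walk G (2 ^ m) = (\<lambda>_. 0)"

definition ring_dist :: "nat \<Rightarrow> nat \<Rightarrow> nat \<Rightarrow> int" where
  "ring_dist m a b = min \<bar>int a - int b\<bar> (int m - \<bar>int a - int b\<bar>)"

definition jump_sum :: "nat \<Rightarrow> nat list \<Rightarrow> int" where
  "jump_sum m G = (\<Sum>t<2 ^ m. ring_dist m (G ! t) (G ! (Suc t mod 2 ^ m)))"

definition mu_jump :: "nat \<Rightarrow> nat list \<Rightarrow> real" where
  "mu_jump m G = real_of_int (jump_sum m G) / 2 ^ m"

datatype row = Upper | Lower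

type_synonym site = "row \<times> nat"

definition grid_edges :: "nat \<Rightarrow> (site \<times> site) set" where
  "grid_edges m =
     {((r, c), (r, Suc c)) | r c. Suc c < m} \<union> {((Upper, c), (Lower, c)) | c. c < m}"

datatype swap_layer = SWAP_A | SWAP_B

fun layer_swaps :: "nat \<Rightarrow> swap_layer \<Rightarrow> (site \<times> site) set" where
  "layer_swaps m SWAP_A =
     {((Upper, c), (Upper, Suc c)) | c. even c \<and> Suc c < m} \<union>
     {((Lower, c), (Lower, Suc c)) | c. odd c \<and> Suc c < m}"
| "layer_swaps m SWAP_B =
     {((Upper, c), (Upper, Suc c)) | c. odd c \<and> Suc c < m} \<union>
     {((Lower, c), (Lower, Suc c)) | c. even c \<and> Suc c < m}"

lemma layer_swaps_nearest_neighbour: "layer_swaps m l \<subseteq> grid_edges m"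
  by (cases l) (auto simp: grid_edges_def)

lemma layer_swaps_parallel:
  assumes "(p, q) \<in> layer_swaps m l" "(p', q') \<in> layer_swaps m l" "(p, q) \<noteq> (p', q')"
  shows "{p, q} \<inter> {p', q'} = {}"
  using assms by (cases l) auto

text \<open>A layout gives the label index at each site: \<open>\<pi> (Upper, i) = a\<close> means that column \<open>i\<close>
  carries $h_a$, and \<open>\<pi> (Lower, i) = b\<close> that it carries $l_b$. Values at columns outside the grid
  are irrelevant. The set \<open>idle\<close> consists of the low labels that are not qubits.\<close>

type_synonym layout = "site \<Rightarrow> nat"

definition num_cols :: "nat \<Rightarrow> nat" where
  "num_cols n = nat \<lceil>real n / 2\<rceil>"

definition idle_low_labels :: "nat \<Rightarrow> nat set \<Rightarrow> bool" where
  "idle_low_labels n idle \<longleftrightarrow>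
     idle \<subseteq> {..<num_cols n} \<and> card idle = (if odd n then 1 else 0)"

definition canonical_label :: "nat \<Rightarrow> nat \<Rightarrow> nat" where
  "canonical_label m j = (if even j then j div 2 else m - 1 - j div 2)"

definition canonical_layout :: "nat \<Rightarrow> layout" where
  "canonical_layout m = (\<lambda>(r, j). canonical_label m j)"

definition col_offset :: "nat \<Rightarrow> layout \<Rightarrow> nat \<Rightarrow> int" where
  "col_offset m \<pi> i = (int (\<pi> (Lower, i)) - int (\<pi> (Upper, i))) mod int m"

definition in_offset_state :: "nat \<Rightarrow> nat set \<Rightarrow> nat \<Rightarrow> layout \<Rightarrow> bool" where
  "in_offset_state m idle d \<pi> \<longleftrightarrow>
     (\<forall>i<m. \<pi> (Lower, i) \<notin> idle \<longrightarrow> col_offset m \<pi> i = int d)"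

lemma canonical_layout_offset: "in_offset_state m idle 0 (canonical_layout m)"
  by (simp add: in_offset_state_def col_offset_def canonical_layout_def)

text \<open>Pairs \<open>(a, b)\<close> stand for the interaction of $h_a$ with $l_b$: first those available on the
  vertical edges of a layout, then those belonging to the matching for offset \<open>d\<close>.\<close>

definition vertical_pairs :: "nat \<Rightarrow> nat set \<Rightarrow> layout \<Rightarrow> (nat \<times> nat) set" where
  "vertical_pairs m idle \<pi> =
     {(\<pi> (Upper, i), \<pi> (Lower, i)) | i. i < m \<and> \<pi> (Lower, i) \<notin> idle}"

definition offset_matching :: "nat \<Rightarrow> nat set \<Rightarrow> nat \<Rightarrow> (nat \<times> nat) set" where
  "offset_matching m idle d = {(a, (a + d) mod m) | a. a < m \<and> (a + d) mod m \<notin> idle}"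

definition swap_partner :: "(site \<times> site) set \<Rightarrow> site \<Rightarrow> site" where
  "swap_partner P s =
     (if \<exists>s'. (s, s') \<in> P \<union> P\<inverse> then THE s'. (s, s') \<in> P \<union> P\<inverse> else s)"

definition apply_layer :: "nat \<Rightarrow> swap_layer \<Rightarrow> layout \<Rightarrow> layout" where
  "apply_layer m l \<pi> = \<pi> \<circ> swap_partner (layer_swaps m l)"

definition run_layers :: "nat \<Rightarrow> swap_layer list \<Rightarrow> layout \<Rightarrow> layout" where
  "run_layers m w \<pi> = fold (apply_layer m) w \<pi>"

definition shortest_move :: "nat \<Rightarrow> nat set \<Rightarrow> layout \<Rightarrow> nat \<Rightarrow> swap_layer list \<Rightarrow> bool" where
  "shortest_move m idle \<pi> d w \<longleftrightarrow>
     in_offset_state m idle d (run_layers m w \<pi>) \<and>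
     (\<forall>w'. in_offset_state m idle d (run_layers m w' \<pi>) \<longrightarrow> length w \<le> length w')"

text \<open>\<open>ws ! t\<close> is the list of layers applied between visit \<open>t\<close> and visit \<open>t + 1\<close>, the last one
  being the return to the first state. The entry layout \<open>\<pi>\<close> is any layout in the first state that
  SWAP layers produce from the canonical arrangement; getting there is not part of the block.\<close>

definition gps_routing ::
  "nat \<Rightarrow> nat set \<Rightarrow> nat list \<Rightarrow> layout \<Rightarrow> swap_layer list list \<Rightarrow> bool" where
  "gps_routing m idle G \<pi> ws \<longleftrightarrow>
     (\<exists>u. \<pi> = run_layers m u (canonical_layout m)) \<and>
     in_offset_state m idle (G ! 0) \<pi> \<and>
     length ws = 2 ^ m \<and>
     (\<forall>t<2 ^ m. let \<rho> = run_layers m (concat (take t ws)) \<pi> in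
        vertical_pairs m idle \<rho> = offset_matching m idle (G ! t) \<and>
        shortest_move m idle \<rho> (G ! (Suc t mod 2 ^ m)) (ws ! t))"

text \<open>A CNOT is a pair (control, target), and a circuit is a list of layers of simultaneous CNOTs.
  Each SWAP on \<open>(p, q)\<close> is CNOT\<open>(p, q)\<close>, CNOT\<open>(q, p)\<close>, CNOT\<open>(p, q)\<close>. Only the SWAPs of a routing
  are charged, not the matchings executed at the visited states.\<close>

definition layer_cnots :: "nat \<Rightarrow> swap_layer \<Rightarrow> (site \<times> site) set list" where
  "layer_cnots m l = (let P = layer_swaps m l in [P, P\<inverse>, P])"

definition routing_cnots :: "nat \<Rightarrow> swap_layer list list \<Rightarrow> (site \<times> site) set list" where
  "routing_cnots m ws = concat (map (layer_cnots m) (concat ws))"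

definition cnot_depth :: "(site \<times> site) set list \<Rightarrow> nat" where
  "cnot_depth C = length C"

definition cnot_count :: "(site \<times> site) set list \<Rightarrow> nat" where
  "cnot_count C = sum_list (map card C)"

end

(* On the canonical columns, relabelled by sigma in Z/m, the two brick patterns of disjoint
   neighbour swaps act as the reflections c -> -1-c and c -> -c. So every layout reachable from the
   canonical one has rows of the form c -> e*c + u and c -> e*c + u + D with a common sign e, and a
   layer flips e and changes the offset D by e (SWAP-A) or -e (SWAP-B). Both directions along the
   offset ring are thus always available at one layer per unit step and nothing is faster, so a
   shortest move takes exactly the ring distance many layers, each with m - 1 swaps. *)

theory Submission
  imports Defs "HOL-Number_Theory.Cong"
begin

section \<open>SWAP layers as permutations of columns\<close>

text \<open>The action of one row of a layer on columns, where \<open>p\<close> says whether the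
  pairing starts at column 0. Unpaired end columns are fixed: the last one by the inner conditional,
  column 0 for \<open>p = False\<close> by truncated subtraction.\<close>

definition brick :: "nat \<Rightarrow> bool \<Rightarrow> nat \<Rightarrow> nat" where
  "brick m p i = (if even i = p then if Suc i < m then Suc i else i else i - 1)"

lemma brick_less: "i < m \<Longrightarrow> brick m p i < m"
  by (auto simp: brick_def)

text \<open>Each adjacent column pair is swapped in exactly one row, selected by the parity of its
  left column. Indexing by that column makes the number of SWAPs immediate.\<close>

lemma layer_swaps_alt:
  "layer_swaps m l = (\<lambda>c. let r = (if even c = (l = SWAP_A) then Upper else Lower)
     in ((r, c), (r, Suc c))) ` {c. Suc c < m}"
  by (cases l) (auto simp: Let_def image_iff split: if_splits)

lemma finite_layer_swaps: "finite (layer_swaps m l)"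
proof -
  have "{c. Suc c < m} \<subseteq> {..<m}" by auto
  then show ?thesis
    unfolding layer_swaps_alt using finite_subset by blast
qed

lemma card_layer_swaps: "card (layer_swaps m l) = m - 1"
proof -
  have "{c. Suc c < m} = {..<m - 1}" by auto
  then show ?thesis
    unfolding layer_swaps_alt by (subst card_image) (auto simp: inj_on_def Let_def)
qed

lemma swap_partner_layer_swaps:
  assumes "i < m"
  shows "swap_partner (layer_swaps m l) (r, i) = (r, brick m ((l = SWAP_A) = (r = Upper)) i)"
proof -
  let ?P = "layer_swaps m l"
  let ?j = "brick m ((l = SWAP_A) = (r = Upper)) i"
  have partner: "((r, i), s) \<in> ?P \<union> ?P\<inverse> \<longleftrightarrow> s = (r, ?j) \<and> ?j \<noteq> i" for s
    using assms by (cases l; cases r; cases s) (auto simp: brick_def split: if_splits elim: oddE)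
  show ?thesis
    unfolding swap_partner_def partner by auto
qed

section \<open>Brick permutations as reflections of canonical labels\<close>

lemma canonical_label_less: "i < m \<Longrightarrow> canonical_label m i < m"
  by (auto simp: canonical_label_def)

lemma inj_on_canonical_label: "inj_on (canonical_label m) {..<m}"
  unfolding inj_on_def canonical_label_def
  by (auto split: if_splits elim!: evenE oddE)

text \<open>Columns 2k and 2k+1 carry k and m-1-k. For odd m the fixed last column carries (m-1)/2,
  which fits the same sum.\<close>

lemma canonical_label_brick_True:
  "i < m \<Longrightarrow> canonical_label m (brick m True i) + canonical_label m i = m - 1"
  by (cases "even i") (auto simp: canonical_label_def brick_def elim!: evenE oddE)

text \<open>Columns 2k+1 and 2k+2 carry m-1-k and k+1. The fixed columns are 0, with label 0, and
  for even m the last one, with label m/2.\<close>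

lemma canonical_label_brick_False:
  assumes "i < m"
  shows "canonical_label m (brick m False i) + canonical_label m i = (if i = 0 then 0 else m)"
proof (cases "even i")
  case True
  then show ?thesis
    using assms by (cases i) (auto simp: canonical_label_def brick_def elim!: oddE)
next
  case False
  then show ?thesis
    using assms by (auto simp: canonical_label_def brick_def elim!: oddE)
qed

lemma cong_canonical_label_brick:
  assumes "i < m"
  shows "[int (canonical_label m (brick m p i)) = (if p then - 1 else 0) - int (canonical_label m i)]
           (mod int m)"
proof -
  have "int (canonical_label m (brick m p i)) - ((if p then - 1 else 0) - int (canonical_label m i))
          \<in> {0, int m}"
    using canonical_label_brick_True[OF assms] canonical_label_brick_False[OF assms] assms
    by (cases p) (auto split: if_splits)
  then show ?thesis
    by (auto simp: cong_iff_dvd_diff)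
qed

section \<open>Dihedral layouts and the effect of layers\<close>

text \<open>\<open>D\<close> is an integer lift of the offset rather than a residue, so that its
  displacement can be compared with the number of layers.\<close>

definition dihedral_layout :: "nat \<Rightarrow> int \<Rightarrow> int \<Rightarrow> layout \<Rightarrow> bool" where
  "dihedral_layout m e D \<pi> \<longleftrightarrow> (e = 1 \<or> e = - 1) \<and>
     (\<exists>u. \<forall>i<m. \<forall>r. \<pi> (r, i) < m \<and>
       [int (\<pi> (r, i)) = e * int (canonical_label m i) + u + (if r = Upper then 0 else D)]
         (mod int m))"

definition layer_shift :: "swap_layer \<Rightarrow> int" where
  "layer_shift l = (if l = SWAP_A then 1 else - 1)"

lemma dihedral_canonical_layout: "dihedral_layout m 1 0 (canonical_layout m)"
  by (auto simp: dihedral_layout_def canonical_layout_def canonical_label_less intro: exI[of _ 0])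

text \<open>Both reflections negate the slope; the row whose pairing starts at column 0 also gains
  the translation \<open>- e\<close>. That row is the upper one for \<open>SWAP_A\<close>, raising
  lower minus upper by \<open>e\<close>, and the lower one for \<open>SWAP_B\<close>, reducing it by
  \<open>e\<close>.\<close>

lemma dihedral_apply_layer:
  assumes "dihedral_layout m e D \<pi>"
  shows "dihedral_layout m (- e) (D + e * layer_shift l) (apply_layer m l \<pi>)"
proof -
  obtain u where e: "e = 1 \<or> e = - 1" and u: "\<And>i r. i < m \<Longrightarrow> \<pi> (r, i) < m \<and>
       [int (\<pi> (r, i)) = e * int (canonical_label m i) + u + (if r = Upper then 0 else D)]
         (mod int m)"
    using assms unfolding dihedral_layout_def by blast
  \<comment> \<open>The new translation of the upper row.\<close>
  define u' where "u' = (if l = SWAP_A then u - e else u)"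
  have "apply_layer m l \<pi> (r, i) < m \<and>
      [int (apply_layer m l \<pi> (r, i)) = - e * int (canonical_label m i) + u'
         + (if r = Upper then 0 else D + e * layer_shift l)] (mod int m)"
    if i: "i < m" for i r
  proof -
    define p where "p \<longleftrightarrow> (l = SWAP_A) = (r = Upper)"
    have ap: "apply_layer m l \<pi> (r, i) = \<pi> (r, brick m p i)"
      using i by (simp add: apply_layer_def swap_partner_layer_swaps p_def)
    note b = u[OF brick_less[OF i], of r p]
    have "[e * int (canonical_label m (brick m p i)) + u + (if r = Upper then 0 else D)
        = e * ((if p then - 1 else 0) - int (canonical_label m i)) + u
           + (if r = Upper then 0 else D)] (mod int m)"
      by (intro cong_add cong_mult cong_refl cong_canonical_label_brick i)
    moreover have "e * ((if p then - 1 else 0) - int (canonical_label m i)) + u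
           + (if r = Upper then 0 else D) = - e * int (canonical_label m i) + u'
         + (if r = Upper then 0 else D + e * layer_shift l)"
      by (cases l; cases r) (auto simp: p_def u'_def layer_shift_def algebra_simps)
    ultimately show ?thesis
      using b unfolding ap by (metis cong_trans)
  qed
  then show ?thesis
    unfolding dihedral_layout_def using e by (intro conjI exI[of _ u']) auto
qed

lemma dihedral_run_layers:
  assumes "dihedral_layout m e D \<pi>"
  obtains e' D' where "dihedral_layout m e' D' (run_layers m w \<pi>)" "\<bar>D' - D\<bar> \<le> int (length w)"
proof -
  have "\<exists>e' D'. dihedral_layout m e' D' (run_layers m w \<pi>) \<and> \<bar>D' - D\<bar> \<le> int (length w)"
    using assms
  proof (induction w arbitrary: e D \<pi>)
    case Nil
    then show ?case by (auto simp: run_layers_def)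
  next
    case (Cons l w)
    from Cons.IH[OF dihedral_apply_layer[OF Cons.prems, of l]]
    obtain e' D' where "dihedral_layout m e' D' (run_layers m (l # w) \<pi>)"
      and D': "\<bar>D' - (D + e * layer_shift l)\<bar> \<le> int (length w)"
      by (auto simp: run_layers_def)
    moreover have "e * layer_shift l = 1 \<or> e * layer_shift l = - 1"
      using Cons.prems by (auto simp: dihedral_layout_def layer_shift_def)
    then have "\<bar>D' - D\<bar> \<le> int (length (l # w))"
      using D' by auto
    ultimately show ?case by blast
  qed
  then show ?thesis using that by blast
qed

text \<open>Whatever the sign \<open>e\<close>, one of the two layers moves the offset one unit in
  the desired direction.\<close>

lemma dihedral_reach:
  assumes "dihedral_layout m e D \<pi>"
  obtains e' w where "dihedral_layout m e' (D + x) (run_layers m w \<pi>)" "int (length w) = \<bar>x\<bar>"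
proof -
  have "\<exists>e' w. dihedral_layout m e' (D + x) (run_layers m w \<pi>) \<and> length w = k"
    if "nat \<bar>x\<bar> = k" for k
    using assms that
  proof (induction k arbitrary: e D x \<pi>)
    case 0
    then show ?case by (auto simp: run_layers_def)
  next
    case (Suc k)
    have e: "e = 1 \<or> e = - 1" using Suc.prems(1) by (simp add: dihedral_layout_def)
    \<comment> \<open>As \<open>e\<close> flips after every layer, this choice alternates A and B;
      repeating a layer would undo it.\<close>
    define l where "l = (if e = sgn x then SWAP_A else SWAP_B)"
    have l: "e * layer_shift l = sgn x"
      using e Suc.prems(2) by (auto simp: l_def layer_shift_def sgn_if)
    have "nat \<bar>x - sgn x\<bar> = k"
      using Suc.prems(2) by (auto simp: sgn_if)
    from Suc.IH[OF dihedral_apply_layer[OF Suc.prems(1), of l] this]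
    obtain e' w where "dihedral_layout m e' (D + x) (run_layers m (l # w) \<pi>)" "length w = k"
      by (auto simp: run_layers_def l)
    then show ?case by (intro exI[of _ e'] exI[of _ "l # w"]) simp
  qed
  then show ?thesis using that by fastforce
qed

section \<open>Offset states and matchings of dihedral layouts\<close>

text \<open>Each row is an affine map of slope 1 or -1 in Z/m applied to distinct canonical
  labels.\<close>

lemma dihedral_inj_on:
  assumes "dihedral_layout m e D \<pi>"
  shows "inj_on (\<lambda>i. \<pi> (r, i)) {..<m}"
proof (rule inj_onI)
  fix i j assume ij: "i \<in> {..<m}" "j \<in> {..<m}" "\<pi> (r, i) = \<pi> (r, j)"
  let ?\<sigma> = "\<lambda>i. int (canonical_label m i)"
  obtain u where e: "e = 1 \<or> e = - 1" and u: "\<And>i. i < m \<Longrightarrow>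
       [int (\<pi> (r, i)) = e * ?\<sigma> i + u + (if r = Upper then 0 else D)] (mod int m)"
    using assms unfolding dihedral_layout_def by blast
  have "[e * ?\<sigma> i + (u + (if r = Upper then 0 else D)) =
         e * ?\<sigma> j + (u + (if r = Upper then 0 else D))] (mod int m)"
    using u[of i] u[of j] ij by (metis add.assoc cong_sym cong_trans lessThan_iff)
  then have "[e * ?\<sigma> i = e * ?\<sigma> j] (mod int m)"
    by (simp only: cong_add_rcancel)
  then have "[?\<sigma> i = ?\<sigma> j] (mod int m)"
    using e by (auto simp: cong_minus_minus_iff)
  then have "canonical_label m i = canonical_label m j"
    using ij canonical_label_less by (simp add: cong_int_iff cong_less_modulus_unique_nat)
  then show "i = j"
    using inj_on_canonical_label ij by (auto dest: inj_onD)
qed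

lemma dihedral_col_offset:
  assumes "dihedral_layout m e D \<pi>" "i < m"
  shows "col_offset m \<pi> i = D mod int m"
proof -
  obtain u where u: "\<And>r.
       [int (\<pi> (r, i)) = e * int (canonical_label m i) + u + (if r = Upper then 0 else D)]
         (mod int m)"
    using assms unfolding dihedral_layout_def by blast
  have "[int (\<pi> (Lower, i)) - int (\<pi> (Upper, i)) = D] (mod int m)"
    using cong_diff[OF u[of Lower] u[of Upper]] by simp
  then show ?thesis by (simp add: col_offset_def cong_def)
qed

text \<open>All columns share the offset \<open>D\<close> mod m, so a single non-idle column
  determines it. Finiteness of \<open>idle\<close> gives the cardinality bound its force, since
  infinite sets have \<open>card\<close> 0.\<close>

lemma dihedral_in_offset_state_iff:
  assumes "dihedral_layout m e D \<pi>" "d < m" "finite idle" "card idle \<le> 1"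
  shows "in_offset_state m idle d \<pi> \<longleftrightarrow> [D = int d] (mod int m)"
proof -
  have eq: "D mod int m = int d \<longleftrightarrow> [D = int d] (mod int m)"
    using assms(2) by (simp add: cong_def)
  consider "m = 1" | "m \<ge> 2" using assms(2) by linarith
  then show ?thesis
  proof cases
    \<comment> \<open>The only column may be idle here, but all integers are congruent modulo
      1.\<close>
    case 1
    then show ?thesis
      using assms(2) by (simp add: in_offset_state_def col_offset_def)
  next
    case 2
    \<comment> \<open>Two distinct lower labels cannot both lie in a set of at most one
      element.\<close>
    have "\<pi> (Lower, 0) \<noteq> \<pi> (Lower, 1)"
      using dihedral_inj_on[OF assms(1), of Lower] 2 by (auto dest!: inj_onD)
    then obtain i where "i < m" "\<pi> (Lower, i) \<notin> idle"
      using assms(3,4) 2 card_le_Suc0_iff_eq[of idle]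
      by (metis One_nat_def Suc_1 Suc_le_lessD less_trans zero_less_one)
    then show ?thesis
      by (auto simp: in_offset_state_def dihedral_col_offset[OF assms(1)] eq)
  qed
qed

lemma dihedral_vertical_pairs:
  assumes "dihedral_layout m e D \<pi>" "[D = int d] (mod int m)"
  shows "vertical_pairs m idle \<pi> = offset_matching m idle d"
proof -
  have less: "\<pi> (r, i) < m" if "i < m" for r i
    using assms(1) that by (auto simp: dihedral_layout_def)
  have lower: "\<pi> (Lower, i) = (\<pi> (Upper, i) + d) mod m" if "i < m" for i
  proof -
    have "[int (\<pi> (Lower, i)) - int (\<pi> (Upper, i)) = int d] (mod int m)"
      using dihedral_col_offset[OF assms(1) that] assms(2) by (simp add: col_offset_def cong_def)
    then have "[int (\<pi> (Lower, i)) = int (\<pi> (Upper, i) + d)] (mod int m)"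
      by (simp add: cong_iff_dvd_diff algebra_simps)
    then show ?thesis
      using less[OF that, of Lower] by (simp only: cong_int_iff) (simp add: cong_def)
  qed
  \<comment> \<open>An injective self-map of a finite set is onto, so every high label occurs in
    some column.\<close>
  have "(\<lambda>i. \<pi> (Upper, i)) ` {..<m} = {..<m}"
    using less by (intro endo_inj_surj dihedral_inj_on[OF assms(1)]) auto
  then have "\<exists>i<m. \<pi> (Upper, i) = a" if "a < m" for a
    using that by (metis imageE lessThan_iff)
  then show ?thesis
    using less lower by (fastforce simp: vertical_pairs_def offset_matching_def)
qed

section \<open>Ring distance as least absolute value in a residue class\<close>

lemma ring_dist_le:
  assumes "a < m" "b < m" "[x = int b - int a] (mod int m)"
  shows "ring_dist m a b \<le> \<bar>x\<bar>"
proof -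
  obtain k where "int b - int a = x + int m * k"
    using assms(3) unfolding cong_iff_lin by blast
  then have x: "x = int b - int a - int m * k" by simp
  consider "k = 0" | "k \<ge> 1" | "k \<le> - 1" by linarith
  then show ?thesis
  proof cases
    case 1
    then show ?thesis by (simp add: x ring_dist_def)
  next
    case 2
    \<comment> \<open>The product \<open>int m * k\<close> is bounded first so that the remaining
      goal is linear: a nonzero multiple of m forces \<bar>x\<bar> \<ge> m - \<bar>b -
      a\<bar>.\<close>
    then have "int m * 1 \<le> int m * k" by (intro mult_left_mono) auto
    then show ?thesis
      using assms(1,2) unfolding x ring_dist_def by linarith
  next
    case 3
    then have "int m * k \<le> int m * (- 1)" by (intro mult_left_mono) auto
    then show ?thesis
      using assms(1,2) unfolding x ring_dist_def by linarith
  qed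
qed

lemma ring_dist_attained:
  assumes "a < m" "b < m"
  obtains x where "[x = int b - int a] (mod int m)" "\<bar>x\<bar> = ring_dist m a b"
proof -
  let ?d = "int b - int a"
  have "[?d = ?d] (mod int m)" "[?d - int m = ?d] (mod int m)" "[?d + int m = ?d] (mod int m)"
    by (simp_all add: cong_iff_dvd_diff)
  \<comment> \<open>Either the direct way, or once around the ring in the direction opposite to the
    sign of \<open>?d\<close>.\<close>
  moreover have "\<bar>?d\<bar> = ring_dist m a b \<or> \<bar>?d - int m\<bar> = ring_dist m a b
      \<or> \<bar>?d + int m\<bar> = ring_dist m a b"
    using assms unfolding ring_dist_def by linarith
  ultimately show ?thesis using that by blast
qed

section \<open>Shortest moves between offset states\<close>

text \<open>The lower bound covers arbitrary layer words, including those that turn back or wind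
  around: the net displacement of the lift is congruent to b - a and at most the word length in
  absolute value.\<close>

lemma dihedral_move_length:
  assumes "dihedral_layout m e D \<pi>" "a < m" "b < m" "finite idle" "card idle \<le> 1"
    and "in_offset_state m idle a \<pi>" "in_offset_state m idle b (run_layers m w \<pi>)"
  shows "ring_dist m a b \<le> int (length w)"
proof -
  obtain e' D' where D': "dihedral_layout m e' D' (run_layers m w \<pi>)" "\<bar>D' - D\<bar> \<le> int (length w)"
    using dihedral_run_layers[OF assms(1)] .
  have "[D' - D = int b - int a] (mod int m)"
    using assms D'(1) by (intro cong_diff) (auto simp: dihedral_in_offset_state_iff)
  from ring_dist_le[OF assms(2,3) this] show ?thesis
    using D'(2) by linarith
qed

lemma dihedral_move_exists:
  assumes "dihedral_layout m e D \<pi>" "a < m" "b < m" "finite idle" "card idle \<le> 1"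
    and "in_offset_state m idle a \<pi>"
  obtains w where "in_offset_state m idle b (run_layers m w \<pi>)" "int (length w) = ring_dist m a b"
proof -
  obtain x where x: "[x = int b - int a] (mod int m)" "\<bar>x\<bar> = ring_dist m a b"
    using ring_dist_attained[OF assms(2,3)] .
  obtain e' w where w: "dihedral_layout m e' (D + x) (run_layers m w \<pi>)" "int (length w) = \<bar>x\<bar>"
    using dihedral_reach[OF assms(1)] .
  have "[D = int a] (mod int m)"
    using assms by (simp add: dihedral_in_offset_state_iff)
  from cong_add[OF this x(1)] have "[D + x = int b] (mod int m)" by simp
  then show ?thesis
    using w x(2) assms by (intro that[of w]) (auto simp: dihedral_in_offset_state_iff)
qed

text \<open>The lower bound is attained, so minimality amounts to having exactly that
  length.\<close>

lemma dihedral_shortest_move_iff: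
  assumes "dihedral_layout m e D \<pi>" "a < m" "b < m" "finite idle" "card idle \<le> 1"
    and "in_offset_state m idle a \<pi>"
  shows "shortest_move m idle \<pi> b w \<longleftrightarrow>
    in_offset_state m idle b (run_layers m w \<pi>) \<and> int (length w) = ring_dist m a b"
proof -
  note lower = dihedral_move_length[OF assms]
  obtain v where "in_offset_state m idle b (run_layers m v \<pi>)" "int (length v) = ring_dist m a b"
    using dihedral_move_exists[OF assms] .
  then show ?thesis
    using lower unfolding shortest_move_def by (metis antisym of_nat_le_iff)
qed

lemma run_layers_append: "run_layers m (v @ w) \<pi> = run_layers m w (run_layers m v \<pi>)"
  by (simp add: run_layers_def)

section \<open>Length and existence of a block routing\<close>

lemma gps_routing_length:
  assumes "set G \<subseteq> {..<m}" "length G = 2 ^ m" "finite idle" "card idle \<le> 1"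
    and "gps_routing m idle G \<pi> ws"
  shows "int (length (concat ws)) = jump_sum m G"
proof -
  have G: "G ! t < m" if "t < 2 ^ m" for t
    using subsetD[OF assms(1) nth_mem[of t G]] assms(2) that by simp
  obtain u where u: "\<pi> = run_layers m u (canonical_layout m)"
    and start: "in_offset_state m idle (G ! 0) \<pi>" and len: "length ws = 2 ^ m"
    and move: "\<And>t. t < 2 ^ m \<Longrightarrow> shortest_move m idle (run_layers m (concat (take t ws)) \<pi>)
          (G ! (Suc t mod 2 ^ m)) (ws ! t)"
    using assms(5) unfolding gps_routing_def Let_def by blast
  have "int (length (ws ! t)) = ring_dist m (G ! t) (G ! (Suc t mod 2 ^ m))" if t: "t < 2 ^ m" for t
  proof -
    let ?\<rho> = "run_layers m (concat (take t ws)) \<pi>"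
    obtain e D where d: "dihedral_layout m e D ?\<rho>"
      unfolding u run_layers_append[symmetric]
      using dihedral_run_layers[OF dihedral_canonical_layout] by blast
    \<comment> \<open>Visit 0 is the entry layout; any later visit is the endpoint of the preceding
      move.\<close>
    have state: "in_offset_state m idle (G ! t) ?\<rho>"
    proof (cases t)
      case 0
      then show ?thesis using start by (simp add: run_layers_def)
    next
      case (Suc s)
      then show ?thesis
        using move[of s] t len
        by (simp add: shortest_move_def take_Suc_conv_app_nth run_layers_append)
    qed
    have "G ! (Suc t mod 2 ^ m) < m" using G by simp
    then show ?thesis
      using move[OF t] dihedral_shortest_move_iff[OF d G[OF t] _ assms(3,4) state] by blast
  qed
  moreover have "length (concat ws) = (\<Sum>t<2 ^ m. length (ws ! t))"
    by (simp add: length_concat sum_list_sum_nth len atLeast0LessThan)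
  ultimately show ?thesis
    by (simp add: jump_sum_def)
qed

text \<open>Keeps the cost formula from being vacuous. Shortest moves are appended one by one, which
  leaves all earlier prefixes intact.\<close>

lemma gps_routing_exists:
  assumes "set G \<subseteq> {..<m}" "length G = 2 ^ m" "finite idle" "card idle \<le> 1"
  shows "\<exists>\<pi> ws. gps_routing m idle G \<pi> ws"
proof -
  have G: "G ! t < m" if "t < 2 ^ m" for t
    using subsetD[OF assms(1) nth_mem[of t G]] assms(2) that by simp
  have "0 < m" using G[of 0] by simp
  \<comment> \<open>The boundary word from the canonical arrangement in offset 0 to the first state;
    it is not part of \<open>ws\<close>.\<close>
  obtain u where u: "in_offset_state m idle (G ! 0) (run_layers m u (canonical_layout m))"
    using dihedral_move_exists[OF dihedral_canonical_layout \<open>0 < m\<close> G[of 0] assms(3,4)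
      canonical_layout_offset] by auto
  define \<pi> where "\<pi> = run_layers m u (canonical_layout m)"
  let ?\<rho> = "\<lambda>ws. run_layers m (concat ws) \<pi>"
  have dih: "\<exists>e D. dihedral_layout m e D (?\<rho> ws)" for ws
    unfolding \<pi>_def run_layers_append[symmetric]
    using dihedral_run_layers[OF dihedral_canonical_layout] by blast
  \<comment> \<open>The index \<open>k mod 2 ^ m\<close> wraps only at \<open>k = 2 ^ m\<close>,
    where the final move closes the cycle.\<close>
  have "\<exists>ws. length ws = k \<and> in_offset_state m idle (G ! (k mod 2 ^ m)) (?\<rho> ws) \<and>
      (\<forall>t<k. in_offset_state m idle (G ! t) (?\<rho> (take t ws)) \<and>
         shortest_move m idle (?\<rho> (take t ws)) (G ! (Suc t mod 2 ^ m)) (ws ! t))"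
    if "k \<le> 2 ^ m" for k
    using that
  proof (induction k)
    case 0
    then show ?case using u by (simp add: \<pi>_def run_layers_def)
  next
    case (Suc k)
    then obtain ws where ws: "length ws = k" "in_offset_state m idle (G ! k) (?\<rho> ws)"
      "\<And>t. t < k \<Longrightarrow> in_offset_state m idle (G ! t) (?\<rho> (take t ws)) \<and>
         shortest_move m idle (?\<rho> (take t ws)) (G ! (Suc t mod 2 ^ m)) (ws ! t)"
      by auto
    obtain e D where d: "dihedral_layout m e D (?\<rho> ws)" using dih by blast
    have g: "G ! k < m" "G ! (Suc k mod 2 ^ m) < m" using G Suc.prems by simp_all
    obtain w where w: "in_offset_state m idle (G ! (Suc k mod 2 ^ m)) (run_layers m w (?\<rho> ws))"
      "int (length w) = ring_dist m (G ! k) (G ! (Suc k mod 2 ^ m))"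
      using dihedral_move_exists[OF d g assms(3,4) ws(2)] .
    then have move: "shortest_move m idle (?\<rho> ws) (G ! (Suc k mod 2 ^ m)) w"
      using dihedral_shortest_move_iff[OF d g assms(3,4) ws(2)] by simp
    have "in_offset_state m idle (G ! t) (?\<rho> (take t (ws @ [w]))) \<and>
        shortest_move m idle (?\<rho> (take t (ws @ [w]))) (G ! (Suc t mod 2 ^ m)) ((ws @ [w]) ! t)"
      if "t < Suc k" for t
    proof (cases "t = k")
      case True
      then show ?thesis using ws(1,2) move by (simp add: nth_append)
    next
      case False
      then have "t < k" using that by simp
      then show ?thesis using ws(1) ws(3)[of t] by (simp add: nth_append)
    qed
    then show ?case
      using ws(1) w(1) by (intro exI[of _ "ws @ [w]"]) (simp add: run_layers_append)
  qed
  from this[of "2 ^ m"] obtain ws where ws: "length ws = 2 ^ m"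
    "\<And>t. t < 2 ^ m \<Longrightarrow> in_offset_state m idle (G ! t) (?\<rho> (take t ws)) \<and>
         shortest_move m idle (?\<rho> (take t ws)) (G ! (Suc t mod 2 ^ m)) (ws ! t)"
    by auto
  \<comment> \<open>The state fixes the lifted offset modulo m, and this in turn fixes all vertical
    pairs.\<close>
  have "vertical_pairs m idle (?\<rho> (take t ws)) = offset_matching m idle (G ! t)"
    if t: "t < 2 ^ m" for t
    using dih[of "take t ws"] dihedral_in_offset_state_iff[OF _ G[OF t] assms(3,4)]
      dihedral_vertical_pairs ws(2)[OF t] by blast
  then have "gps_routing m idle G \<pi> ws"
    using ws u by (auto simp: gps_routing_def Let_def \<pi>_def)
  then show ?thesis by blast
qed

section \<open>CNOT cost of a routing\<close>

lemma cnot_depth_routing_cnots: "cnot_depth (routing_cnots m ws) = 3 * length (concat ws)"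
proof -
  have "length (concat (map (layer_cnots m) ls)) = 3 * length ls" for ls
    by (induction ls) (auto simp: layer_cnots_def Let_def)
  then show ?thesis by (simp add: cnot_depth_def routing_cnots_def)
qed

lemma cnot_count_routing_cnots:
  "cnot_count (routing_cnots m ws) = 3 * (m - 1) * length (concat ws)"
proof -
  have "sum_list (map card (concat (map (layer_cnots m) ls))) = 3 * (m - 1) * length ls" for ls
    by (induction ls)
      (auto simp: layer_cnots_def Let_def card_layer_swaps finite_layer_swaps)
  then show ?thesis by (simp add: cnot_count_def routing_cnots_def)
qed

theorem theorem3:
  fixes n :: nat and idle :: "nat set" and G :: "nat list"
  assumes "idle_low_labels n idle"
    and "closed_gray_code (num_cols n) G"
  shows "(\<exists>\<pi> ws. gps_routing (num_cols n) idle G \<pi> ws) \<and>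
    (\<forall>\<pi> ws. gps_routing (num_cols n) idle G \<pi> ws \<longrightarrow>
       real (cnot_depth (routing_cnots (num_cols n) ws))
         = 3 * real_of_int (jump_sum (num_cols n) G) \<and>
       3 * real_of_int (jump_sum (num_cols n) G)
         = 3 * mu_jump (num_cols n) G * 2 ^ num_cols n \<and>
       real (cnot_count (routing_cnots (num_cols n) ws))
         = 3 * (real (num_cols n) - 1) * real_of_int (jump_sum (num_cols n) G) \<and>
       3 * (real (num_cols n) - 1) * real_of_int (jump_sum (num_cols n) G)
         = 3 * (real (num_cols n) - 1) * mu_jump (num_cols n) G * 2 ^ num_cols n)"
proof -
  let ?m = "num_cols n"
  have G: "set G \<subseteq> {..<?m}" "length G = 2 ^ ?m"
    using assms(2) by (auto simp: closed_gray_code_def)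
  have idle: "finite idle" "card idle \<le> 1"
    using assms(1) by (auto simp: idle_low_labels_def intro: finite_subset)
  \<comment> \<open>With no coordinates the transition sequence would still have one entry.
    Positivity makes the natural-number difference \<open>?m - 1\<close> agree with the real
    one.\<close>
  have "?m \<noteq> 0"
    using G by (cases G) auto
  then have m: "real (?m - 1) = real ?m - 1" by simp
  have mu: "real_of_int (jump_sum ?m G) = mu_jump ?m G * 2 ^ ?m"
    by (simp add: mu_jump_def)
  have len: "real (length (concat ws)) = real_of_int (jump_sum ?m G)"
    if "gps_routing ?m idle G \<pi> ws" for \<pi> ws
    using gps_routing_length[OF G idle that] by linarith
  show ?thesis
  proof (intro conjI allI impI)
    show "\<exists>\<pi> ws. gps_routing ?m idle G \<pi> ws"
      by (rule gps_routing_exists[OF G idle])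
  next
    fix \<pi> ws assume r: "gps_routing ?m idle G \<pi> ws"
    show "real (cnot_depth (routing_cnots ?m ws)) = 3 * real_of_int (jump_sum ?m G)"
      using len[OF r] by (simp only: cnot_depth_routing_cnots of_nat_mult of_nat_numeral)
    show "real (cnot_count (routing_cnots ?m ws))
        = 3 * (real ?m - 1) * real_of_int (jump_sum ?m G)"
      using len[OF r] by (simp only: cnot_count_routing_cnots of_nat_mult of_nat_numeral m)
  qed (simp_all add: mu)
qed

end
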